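(* For any uncountable cardinal $\kappa<\mathfrak c$, $C_9(\mathfrak c,\kappa)$ implies $C_8(\mathfrak c,\mathfrak c)$.
   Context: $\mathfrak c=2^{\aleph_0}$. For uncountable cardinals $\kappa\leq\lambda\leq\mathfrak c$: $C_8(\lambda,\kappa)$ denotes the statement: there exist a set $E\subseteq\mathbb R$ of cardinality $\lambda$ and a continuous function $f:E\to\mathbb R$ which is not uniformly continuous on any subset of $E$ of cardinality $\kappa$. $C_9(\lambda,\kappa)$ denotes the statement: there exist a set $E\subseteq\mathbb R$ of cardinality $\lambda$ and a sequence of functions $f_n:E\to\mathbb R$ converging pointwise on $E$ but not converging uniformly on any subset of $E$ of cardinality $\kappa$. *)

theory Defs
  imports "HOL-Analysis.Analysis"
begin

unbundle cardinal_syntax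

text \<open>
  Cardinals are cardinal orders in the sense of the library (\<^const>\<open>Card_order\<close>), compared with
  \<open><o\<close> and \<open>=o\<close> across types.  A partial function \<open>E \<rightarrow> \<real>\<close> is represented by a total function
  of which only the values on \<open>E\<close> matter.  The parameters \<open>\<mu>\<close> and \<open>\<kappa>\<close> of \<open>C8\<close> and \<open>C9\<close>
  are meant to be uncountable cardinals with \<open>\<kappa> \<le>o \<mu>\<close> and \<open>\<mu> \<le>o continuum\<close>.
\<close>

abbreviation continuum :: "(nat \<Rightarrow> bool) rel"
  where "continuum \<equiv> ctwo ^c natLeq"

definition uncountable_cardinal :: "'k rel \<Rightarrow> bool"
  where "uncountable_cardinal \<kappa> \<longleftrightarrow> Card_order \<kappa> \<and> natLeq <o \<kappa>"

definition C8 :: "'l rel \<Rightarrow> 'k rel \<Rightarrow> bool"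
  where "C8 \<mu> \<kappa> \<longleftrightarrow>
    (\<exists>(E :: real set) (f :: real \<Rightarrow> real).
      |E| =o \<mu> \<and> continuous_on E f \<and>
      (\<forall>A\<subseteq>E. |A| =o \<kappa> \<longrightarrow> \<not> uniformly_continuous_on A f))"

definition C9 :: "'l rel \<Rightarrow> 'k rel \<Rightarrow> bool"
  where "C9 \<mu> \<kappa> \<longleftrightarrow>
    (\<exists>(E :: real set) (f :: nat \<Rightarrow> real \<Rightarrow> real).
      |E| =o \<mu> \<and> (\<forall>x\<in>E. convergent (\<lambda>n. f n x)) \<and>
      (\<forall>A\<subseteq>E. |A| =o \<kappa> \<longrightarrow> \<not> uniformly_convergent_on A f))"

end

theory Submission
  imports Defs
begin

text \<open>
  Sending a point to its moduli of convergence shows that fewer than continuum many functions cannot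
  dominate: otherwise the domain would be a union of fewer than continuum many sets of uniform
  convergence, each of cardinality below \<open>\<kappa>\<close>, hence too small because \<open>\<kappa>\<close> is below the continuum.

  Points of the new set are strictly increasing sequences \<open>\<sigma>\<close>, embedded in the line by coding
  their ranges in the Cantor set, and the function maps \<open>\<sigma>\<close> to the code of its parities.
  Uniform continuity on \<open>A\<close> yields a countable family of guesses for the parity sequence, one
  for each initial segment \<open>s\<close> (the limit of the parities as the entry after \<open>s\<close> tends to
  infinity), such that every \<open>\<sigma>\<close> in \<open>A\<close> whose parities differ from all guesses is dominated
  by a function depending only on the guesses, the modulus and the parity sequence. Well-order these data in
  the order type of the continuum. At stage \<open>\<alpha>\<close> first fix parities avoiding all earlier guesses,
  and only then choose \<open>\<sigma>\<close> with these parities outside the fewer than continuum many bounds.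
\<close>

section \<open>Coding binary sequences in the line\<close>

text \<open>The values form the middle-third Cantor set scaled by 3/2.\<close>

definition ternary_code :: "(nat \<Rightarrow> bool) \<Rightarrow> real" where
  "ternary_code b = (\<Sum>n. of_bool (b n) / 3 ^ n)"

lemma summable_ternary: "summable (\<lambda>n. of_bool (b n) / 3 ^ n :: real)"
proof (rule summable_comparison_test'[where N = 0])
  show "summable (\<lambda>n. (1/3) ^ n :: real)" by (rule summable_geometric) simp
qed (simp add: power_one_over)

lemma ternary_code_le_dist:
  assumes "\<And>i. i < n \<Longrightarrow> a i = b i"
  shows "\<bar>ternary_code a - ternary_code b\<bar> \<le> 3 / 2 / 3 ^ n"
proof -
  let ?d = "\<lambda>i. (of_bool (a i) - of_bool (b i)) / 3 ^ i :: real"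
  have sd: "summable ?d"
    using summable_diff[OF summable_ternary[of a] summable_ternary[of b]] by (simp add: diff_divide_distrib)
  have "ternary_code a - ternary_code b = suminf ?d"
    unfolding ternary_code_def
    using suminf_diff[OF summable_ternary[of a] summable_ternary[of b]] by (simp add: diff_divide_distrib)
  also have "\<dots> = (\<Sum>i. ?d (i + n))"
    using suminf_split_initial_segment[OF sd, of n] assms by simp
  finally have eq: "ternary_code a - ternary_code b = (\<Sum>i. ?d (i + n))" .
  have g: "(\<lambda>i. (1/3) ^ i * (1 / 3 ^ n) :: real) sums (3 / 2 / 3 ^ n)"
    using sums_mult2[OF geometric_sums[of "1/3 :: real"], of "1 / 3 ^ n"] by simp
  have "norm (?d (i + n)) \<le> (1/3) ^ i * (1 / 3 ^ n)" for i
    by (auto simp: power_add power_one_over field_simps)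
  then have "norm (\<Sum>i. ?d (i + n)) \<le> (\<Sum>i. (1/3) ^ i * (1 / 3 ^ n))"
    by (intro norm_suminf_le sums_summable[OF g])
  then show ?thesis
    using eq sums_unique[OF g] by simp
qed

lemma ternary_code_ge_dist:
  assumes "\<And>i. i < n \<Longrightarrow> a i = b i" and "a n \<noteq> b n"
  shows "\<bar>ternary_code a - ternary_code b\<bar> \<ge> 1 / 2 / 3 ^ n"
proof -
  \<comment> \<open>\<open>c\<close> follows \<open>a\<close> through place \<open>n\<close> and
    \<open>b\<close> after it: the jump from \<open>b\<close> to \<open>c\<close> has size exactly
    \<open>1 / 3 ^ n\<close>, and the later places can undo at most half of it.\<close>
  define c where "c = b(n := a n)"
  have 1: "\<bar>ternary_code a - ternary_code c\<bar> \<le> 3 / 2 / 3 ^ Suc n"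
    by (rule ternary_code_le_dist) (auto simp: c_def less_Suc_eq assms(1))
  have "ternary_code c - ternary_code b = (\<Sum>i. (of_bool (c i) - of_bool (b i)) / 3 ^ i)"
    unfolding ternary_code_def
    using suminf_diff[OF summable_ternary[of c] summable_ternary[of b]] by (simp add: diff_divide_distrib)
  also have "\<dots> = (\<Sum>i\<in>{n}. (of_bool (c i) - of_bool (b i)) / 3 ^ i)"
    by (rule suminf_finite) (auto simp: c_def)
  finally have "\<bar>ternary_code c - ternary_code b\<bar> = 1 / 3 ^ n"
    using assms(2) by (auto simp: c_def)
  moreover have "3 / 2 / 3 ^ Suc n = (1 / 2 / 3 ^ n :: real)" "1 / 3 ^ n = 2 * (1 / 2 / 3 ^ n :: real)"
    by simp_all
  ultimately show ?thesis using 1 by linarith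
qed

lemma ternary_code_agree:
  assumes "\<bar>ternary_code a - ternary_code b\<bar> < 1 / 2 / 3 ^ n" and "i \<le> n"
  shows "a i = b i"
proof (rule ccontr)
  assume "a i \<noteq> b i"
  define m where "m = (LEAST j. a j \<noteq> b j)"
  have m: "a m \<noteq> b m" "m \<le> i"
    unfolding m_def using \<open>a i \<noteq> b i\<close>
    by (rule LeastI[of "\<lambda>j. a j \<noteq> b j"], rule Least_le[of "\<lambda>j. a j \<noteq> b j"])
  have "\<bar>ternary_code a - ternary_code b\<bar> \<ge> 1 / 2 / 3 ^ m"
    using m(1) not_less_Least by (intro ternary_code_ge_dist) (auto simp: m_def)
  moreover have "(1 / 2 / 3 ^ n :: real) \<le> 1 / 2 / 3 ^ m"
    using m(2) assms(2) by (intro divide_left_mono power_increasing) auto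
  ultimately show False using assms(1) by linarith
qed

text \<open>If the earlier entries agree, the \<open>k\<close>-th entry of either sequence, lying in
  the range of the other, cannot be one of the earlier entries there. So each is at least the other.
  The first comparison also keeps \<open>\<tau> k\<close> within \<open>M\<close>, as the second
  requires.\<close>

lemma strict_mono_agree:
  fixes \<sigma> \<tau> :: "nat \<Rightarrow> nat"
  assumes "strict_mono \<sigma>" "strict_mono \<tau>"
    and "\<And>i. i \<le> M \<Longrightarrow> i \<in> range \<sigma> \<longleftrightarrow> i \<in> range \<tau>"
    and "\<sigma> k \<le> M"
  shows "\<sigma> k = \<tau> k"
  using assms(4)
proof (induction k rule: less_induct)
  case (less k)
  have eq: "\<sigma> i = \<tau> i" if "i < k" for i
    using less.IH[OF that] less.prems strict_monoD[OF assms(1) that] by simp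
  obtain j where j: "\<sigma> k = \<tau> j" using assms(3)[OF less.prems] by auto
  have "k \<le> j"
  proof (rule ccontr)
    assume "\<not> k \<le> j"
    then have "j < k" by simp
    then show False using j eq[of j] strict_monoD[OF assms(1), of j k] by simp
  qed
  then have le: "\<tau> k \<le> \<sigma> k" by (simp add: j strict_mono_less_eq[OF assms(2)])
  then obtain l where l: "\<tau> k = \<sigma> l" using assms(3)[of "\<tau> k"] less.prems by auto
  have "k \<le> l"
  proof (rule ccontr)
    assume "\<not> k \<le> l"
    then have "l < k" by simp
    then show False using l eq[of l] strict_monoD[OF assms(2), of l k] by simp
  qed
  then have "\<sigma> k \<le> \<tau> k" by (simp add: l strict_mono_less_eq[OF assms(1)])
  with le show ?case by simp
qed

section \<open>Guesses, moduli and domination\<close>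

text \<open>
  A point \<open>\<beta>\<close> of the Cantor space encodes guesses for the parities, indexed by codes of finite
  initial segments, and a modulus of uniform continuity. The modulus has an arbitrary value where
  \<open>\<beta>\<close> encodes none.
\<close>

definition guess :: "(nat \<Rightarrow> bool) \<Rightarrow> nat \<Rightarrow> nat \<Rightarrow> bool" where
  "guess \<beta> s j = \<beta> (2 * prod_encode (s, j))"

definition bound :: "(nat \<Rightarrow> bool) \<Rightarrow> nat \<Rightarrow> nat" where
  "bound \<beta> j = (LEAST n. \<beta> (2 * prod_encode (j, n) + 1))"

text \<open>Even places hold \<open>G\<close> and odd places the graph of \<open>N\<close>, so a
  well-order of the Cantor space lists all such pairs.\<close>

lemma ex_guess_bound: "\<exists>\<beta>. guess \<beta> = G \<and> bound \<beta> = N"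
proof -
  define \<beta> where "\<beta> m = (case prod_decode (m div 2) of (p, q) \<Rightarrow> if even m then G p q else q = N p)" for m
  have "guess \<beta> s j = G s j" "bound \<beta> j = N j" for s j
    by (auto simp: \<beta>_def guess_def bound_def intro: Least_equality)
  then show ?thesis by blast
qed

text \<open>What uniform continuity leaves behind: \<open>bound \<beta> j\<close> tells how much of
  the range decides the parity of entry \<open>j\<close>. If \<open>\<sigma> k\<close> exceeds it,
  the first \<open>k\<close> entries already show that part, so the guess made from them must be
  right.\<close>

definition captured :: "(nat \<Rightarrow> bool) \<Rightarrow> (nat \<Rightarrow> nat) \<Rightarrow> bool" where
  "captured \<beta> \<sigma> \<longleftrightarrow>
    (\<forall>k j. odd (\<sigma> j) \<noteq> guess \<beta> (set_encode (\<sigma> ` {..<k})) j \<longrightarrow> \<sigma> k \<le> bound \<beta> j)"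

text \<open>Every initial segment has a place where its guess misses \<open>y\<close>, and capture
  bounds the next entry by the modulus at that place.\<close>

lemma captured_dominated:
  assumes "\<And>s. y \<noteq> guess \<beta> s"
  shows "\<exists>g. \<forall>\<sigma>. (\<forall>j. odd (\<sigma> j) = y j) \<and> captured \<beta> \<sigma> \<longrightarrow> (\<forall>k. \<sigma> k \<le> g k)"
proof -
  define h where "h s = bound \<beta> (LEAST j. y j \<noteq> guess \<beta> (set_encode s) j)" for s
  \<comment> \<open>The initial segment is unknown, but its entries are at most \<open>m\<close>, so
    a maximum over finitely many sets covers it. Inserting \<open>m\<close> makes \<open>g\<close>
    monotone.\<close>
  define g where "g = rec_nat (h {}) (\<lambda>k m. Max (insert m (h ` Pow {..m})))"
  have g_Suc: "g (Suc k) = Max (insert (g k) (h ` Pow {..g k}))" for k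
    by (simp add: g_def)
  have mono: "mono g"
    unfolding mono_iff_le_Suc g_Suc by (intro allI Max_ge) simp_all
  have "\<sigma> k \<le> g k" if y: "\<forall>j. odd (\<sigma> j) = y j" and c: "captured \<beta> \<sigma>" for \<sigma> k
  proof (induction k rule: less_induct)
    case (less k)
    let ?s = "\<sigma> ` {..<k}"
    have "\<exists>j. y j \<noteq> guess \<beta> (set_encode ?s) j"
      using assms[of "set_encode ?s"] by auto
    from LeastI_ex[OF this] have \<sigma>: "\<sigma> k \<le> h ?s"
      using c y unfolding captured_def h_def by blast
    show ?case
    proof (cases k)
      case 0
      then show ?thesis using \<sigma> by (simp add: g_def)
    next
      case (Suc l)
      have "\<sigma> i \<le> g l" if "i < k" for i
        using less.IH[OF that] monoD[OF mono, of i l] that Suc by simp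
      then have "?s \<in> Pow {..g l}" by blast
      then have "h ?s \<le> g k"
        unfolding Suc g_Suc by (intro Max_ge insertI2 imageI) simp_all
      with \<sigma> show ?thesis by simp
    qed
  qed
  then show ?thesis by blast
qed

section \<open>Cardinalities below the continuum\<close>

lemma continuum_eq: "continuum = |UNIV :: (nat \<Rightarrow> bool) set|"
  by (simp add: cexp_def ctwo_def Field_natLeq Field_card_of Func_def)

lemma nat_less_continuum: "|UNIV :: nat set| <o continuum"
  by (rule ordIso_ordLess_trans[OF card_of_nat ordLess_ctwo_cexp[OF natLeq_Card_order]])

lemma infinite_continuum: "infinite (UNIV :: (nat \<Rightarrow> bool) set)"
  by (simp add: finite_UNIV_fun)

text \<open>Each \<open>\<beta>\<close> makes countably many guesses, so \<open>S\<close> supplies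
  fewer than continuum many odd halves. A new odd half defeats them all and leaves the even half
  free for \<open>\<alpha>\<close>.\<close>

lemma ex_parity_avoiding_guesses:
  assumes "|S| <o continuum"
  shows "\<exists>y. (\<forall>n. y (2 * n) = \<alpha> n) \<and> (\<forall>\<beta>\<in>S. \<forall>s. y \<noteq> guess \<beta> s)"
proof -
  let ?V = "\<Union>\<beta>\<in>S. range (\<lambda>s n. guess \<beta> s (2 * n + 1))"
  let ?K = "(UNIV :: nat set) <+> S"
  have "|?V| \<le>o |?K|"
  proof (rule card_of_UNION_ordLeq_infinite)
    show "infinite ?K" by (simp add: finite_Plus_iff)
    show "|S| \<le>o |?K|" by (rule card_of_Plus2)
    show "\<forall>\<beta>\<in>S. |range (\<lambda>s n. guess \<beta> s (2 * n + 1))| \<le>o |?K|"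
      using ordLeq_transitive[OF card_of_image card_of_Plus1] by blast
  qed
  moreover have "|?K| <o |UNIV :: (nat \<Rightarrow> bool) set|"
    using card_of_Plus_ordLess_infinite[OF infinite_continuum nat_less_continuum[unfolded continuum_eq]]
      assms[unfolded continuum_eq] .
  ultimately have "|?V| <o |UNIV :: (nat \<Rightarrow> bool) set|"
    by (rule ordLeq_ordLess_trans)
  then have "?V \<noteq> UNIV"
    using ordLess_irreflexive[of "|UNIV :: (nat \<Rightarrow> bool) set|"] by auto
  then obtain v where v: "v \<notin> ?V" by blast
  define y where "y n = (if even n then \<alpha> (n div 2) else v (n div 2))" for n
  have "y \<noteq> guess \<beta> s" if "\<beta> \<in> S" for \<beta> s
  proof
    assume "y = guess \<beta> s"
    then have "y (2 * n + 1) = guess \<beta> s (2 * n + 1)" for n by simp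
    then have "v = (\<lambda>n. guess \<beta> s (2 * n + 1))" by (simp add: y_def fun_eq_iff)
    with v that show False by blast
  qed
  then show ?thesis by (intro exI[of _ y]) (auto simp: y_def)
qed

lemma C9_not_dominating:
  fixes \<kappa> :: "'k rel" and g :: "'a \<Rightarrow> nat \<Rightarrow> nat"
  assumes "uncountable_cardinal \<kappa>" and "\<kappa> <o continuum" and "C9 continuum \<kappa>"
    and S: "|S| <o continuum"
  shows "\<exists>x. \<forall>\<beta>\<in>S. \<exists>k. g \<beta> k < x k"
proof (rule ccontr)
  assume "\<not> ?thesis"
  then have dom: "\<exists>\<beta>\<in>S. \<forall>k. x k \<le> g \<beta> k" for x
    by (auto simp: not_less)
  obtain E :: "real set" and f :: "nat \<Rightarrow> real \<Rightarrow> real" where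
    E: "|E| =o continuum" and conv: "\<And>x. x \<in> E \<Longrightarrow> convergent (\<lambda>n. f n x)"
    and unif: "\<And>A. A \<subseteq> E \<Longrightarrow> |A| =o \<kappa> \<Longrightarrow> \<not> uniformly_convergent_on A f"
    using assms(3) unfolding C9_def by blast
  have \<kappa>: "Card_order \<kappa>" "natLeq <o \<kappa>" using assms(1) by (auto simp: uncountable_cardinal_def)
  define r where "r x k = (LEAST m. \<forall>n\<ge>m. dist (f n x) (lim (\<lambda>n. f n x)) < inverse (Suc k))" for x k
  have r: "dist (f n x) (lim (\<lambda>n. f n x)) < inverse (Suc k)" if "x \<in> E" "r x k \<le> n" for x k n
  proof -
    have "(\<lambda>n. f n x) \<longlonglongrightarrow> lim (\<lambda>n. f n x)"
      using conv[OF that(1)] by (simp add: convergent_LIMSEQ_iff)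
    then have "\<exists>m. \<forall>n\<ge>m. dist (f n x) (lim (\<lambda>n. f n x)) < inverse (Suc k)"
      by (metis inverse_positive_iff_positive lim_sequentially of_nat_0_less_iff zero_less_Suc)
    from LeastI_ex[OF this] that(2) show ?thesis unfolding r_def by blast
  qed
  define B where "B \<beta> = {x \<in> E. \<forall>k. r x k \<le> g \<beta> k}" for \<beta>
  have B: "uniformly_convergent_on (B \<beta>) f" for \<beta>
    unfolding uniformly_convergent_on_def uniform_limit_sequentially_iff
  proof (intro exI[of _ "\<lambda>x. lim (\<lambda>n. f n x)"] allI impI)
    fix e :: real assume "e > 0"
    then obtain k where k: "inverse (real (Suc k)) < e" using reals_Archimedean by blast
    have "dist (f n x) (lim (\<lambda>n. f n x)) < e" if "g \<beta> k \<le> n" "x \<in> B \<beta>" for n x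
    proof -
      have "x \<in> E" "r x k \<le> n" using that unfolding B_def by (auto intro: order_trans)
      from r[OF this] k show ?thesis by (rule less_trans)
    qed
    then show "\<exists>N. \<forall>n\<ge>N. \<forall>x\<in>B \<beta>. dist (f n x) (lim (\<lambda>n. f n x)) < e" by blast
  qed
  \<comment> \<open>\<open>unif\<close> concerns sets of cardinality exactly
    \<open>\<kappa>\<close>, so a larger \<open>B \<beta>\<close> is cut down to such a set.\<close>
  have small: "|B \<beta>| \<le>o |Field \<kappa>|" for \<beta>
  proof (rule ccontr)
    assume "\<not> ?thesis"
    then have "|Field \<kappa>| \<le>o |B \<beta>|"
      using ordLeq_total[OF card_of_Well_order card_of_Well_order] by blast
    then obtain A where A: "A \<subseteq> B \<beta>" "|Field \<kappa>| =o |A|"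
      unfolding internalize_card_of_ordLeq2[of "Field \<kappa>" "B \<beta>"] by blast
    have "|A| =o \<kappa>"
      by (rule ordIso_transitive[OF ordIso_symmetric[OF A(2)] card_of_Field_ordIso[OF \<kappa>(1)]])
    moreover have "A \<subseteq> E" using A(1) by (auto simp: B_def)
    moreover have "uniformly_convergent_on A f"
      using B[of \<beta>] A(1) uniform_limit_on_subset unfolding uniformly_convergent_on_def by blast
    ultimately show False using unif[of A] by blast
  qed
  have inf: "infinite (Field \<kappa>)"
    using cinfinite_mono[OF ordLess_imp_ordLeq[OF \<kappa>(2)] natLeq_cinfinite] by (simp add: cinfinite_def)
  \<comment> \<open>All pieces obey the same bound \<open>\<kappa>\<close>, so the union stays below
    the continuum even if the continuum is singular.\<close>
  let ?K = "Field \<kappa> <+> S"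
  have "E = (\<Union>\<beta>\<in>S. B \<beta>)"
    using dom by (force simp: B_def)
  also have "|\<Union>\<beta>\<in>S. B \<beta>| \<le>o |?K|"
  proof (rule card_of_UNION_ordLeq_infinite)
    show "infinite ?K" using inf by (simp add: finite_Plus_iff)
    show "|S| \<le>o |?K|" by (rule card_of_Plus2)
    show "\<forall>\<beta>\<in>S. |B \<beta>| \<le>o |?K|" using ordLeq_transitive[OF small card_of_Plus1] by blast
  qed
  finally have "|E| \<le>o |?K|" .
  moreover have "|?K| <o continuum"
    unfolding continuum_eq
  proof (rule card_of_Plus_ordLess_infinite[OF infinite_continuum])
    show "|Field \<kappa>| <o |UNIV :: (nat \<Rightarrow> bool) set|"
      using ordIso_ordLess_trans[OF card_of_Field_ordIso[OF \<kappa>(1)] assms(2)]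
      unfolding continuum_eq .
  qed (use S continuum_eq in simp)
  ultimately have "|E| <o continuum"
    by (rule ordLeq_ordLess_trans)
  with E show False using not_ordLess_ordIso[of "|E|" continuum] by simp
qed

text \<open>\<open>nd\<close> says that the dominating number equals the continuum.\<close>

lemma C8_continuum_if_not_dominating:
  assumes nd: "\<And>(g :: (nat \<Rightarrow> bool) \<Rightarrow> nat \<Rightarrow> nat) S.
    |S| <o continuum \<Longrightarrow> \<exists>x. \<forall>\<beta>\<in>S. \<exists>k. g \<beta> k < x k"
  shows "C8 continuum continuum"
proof -
  let ?prec = "underS |UNIV :: (nat \<Rightarrow> bool) set|"
  have prec: "|?prec \<alpha>| <o continuum" for \<alpha>
    using card_of_underS[OF card_of_Card_order[of "UNIV :: (nat \<Rightarrow> bool) set"], of \<alpha>]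
    unfolding continuum_eq by (simp add: Field_card_of)
  \<comment> \<open>Storing \<open>\<alpha>\<close> in the even-indexed parities makes the choices distinct without transfinite recursion.\<close>
  have "\<exists>\<sigma>. strict_mono \<sigma> \<and> (\<forall>n. odd (\<sigma> (2 * n)) = \<alpha> n) \<and> (\<forall>\<beta>\<in>?prec \<alpha>. \<not> captured \<beta> \<sigma>)" for \<alpha>
  proof -
    obtain y where y: "\<And>n. y (2 * n) = \<alpha> n" "\<And>\<beta> s. \<beta> \<in> ?prec \<alpha> \<Longrightarrow> y \<noteq> guess \<beta> s"
      using ex_parity_avoiding_guesses[OF prec] by metis
    have "\<forall>\<beta>\<in>?prec \<alpha>. \<exists>g. \<forall>\<sigma>. (\<forall>j. odd (\<sigma> j) = y j) \<and> captured \<beta> \<sigma> \<longrightarrow> (\<forall>k. \<sigma> k \<le> g k)"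
      using captured_dominated y(2) by blast
    then obtain g where g: "\<And>\<beta> \<sigma> k. \<beta> \<in> ?prec \<alpha> \<Longrightarrow> \<forall>j. odd (\<sigma> j) = y j \<Longrightarrow> captured \<beta> \<sigma> \<Longrightarrow> \<sigma> k \<le> g \<beta> k"
      by metis
    obtain x where x: "\<And>\<beta>. \<beta> \<in> ?prec \<alpha> \<Longrightarrow> \<exists>k. g \<beta> k < x k"
      using nd[OF prec] by blast
    \<comment> \<open>The sums grow by at least 1, so after doubling the gap of 2 absorbs the parity
      bit.\<close>
    define \<sigma> where "\<sigma> k = 2 * (\<Sum>i\<le>k. Suc (x i)) + of_bool (y k)" for k
    have x_le: "x k \<le> \<sigma> k" for k
    proof -
      have "Suc (x k) \<le> (\<Sum>i\<le>k. Suc (x i))"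
        by (rule member_le_sum[of k "{..k}" "\<lambda>i. Suc (x i)"]) auto
      then show ?thesis by (simp add: \<sigma>_def)
    qed
    have par: "odd (\<sigma> k) = y k" for k by (simp add: \<sigma>_def)
    have "\<not> captured \<beta> \<sigma>" if \<beta>: "\<beta> \<in> ?prec \<alpha>" for \<beta>
    proof
      assume "captured \<beta> \<sigma>"
      then have "\<sigma> k \<le> g \<beta> k" for k using g[OF \<beta>] par by blast
      moreover obtain k where "g \<beta> k < x k" using x[OF \<beta>] by blast
      ultimately show False using x_le[of k] by (meson leD order_trans)
    qed
    moreover have "strict_mono \<sigma>"
      by (rule strict_mono_Suc_iff[THEN iffD2]) (auto simp: \<sigma>_def)
    ultimately show ?thesis
      using y(1) par by blast
  qed
  then obtain \<sigma> where sm: "\<And>\<alpha>. strict_mono (\<sigma> \<alpha>)"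
    and par: "\<And>\<alpha> n. odd (\<sigma> \<alpha> (2 * n)) = \<alpha> n"
    and nc: "\<And>\<alpha> \<beta>. \<beta> \<in> ?prec \<alpha> \<Longrightarrow> \<not> captured \<beta> (\<sigma> \<alpha>)"
    by metis
  define e where "e \<alpha> = ternary_code (\<lambda>i. i \<in> range (\<sigma> \<alpha>))" for \<alpha>
  define y where "y \<alpha> = ternary_code (\<lambda>j. odd (\<sigma> \<alpha> j))" for \<alpha>
  have agree: "i \<in> range (\<sigma> \<alpha>) \<longleftrightarrow> i \<in> range (\<sigma> \<beta>)"
    if "dist (e \<alpha>) (e \<beta>) < 1 / 2 / 3 ^ n" "i \<le> n" for \<alpha> \<beta> n i
    using ternary_code_agree that unfolding e_def dist_real_def by blast
  \<comment> \<open>Equal codes give equal ranges, hence equal sequences, whose even-indexed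
    parities return \<open>\<alpha>\<close>.\<close>
  have "\<alpha> = \<beta>" if "e \<alpha> = e \<beta>" for \<alpha> \<beta>
  proof -
    have "\<sigma> \<alpha> k = \<sigma> \<beta> k" for k
      by (rule strict_mono_agree[OF sm sm _ order_refl]) (use agree that in auto)
    then have "odd (\<sigma> \<alpha> (2 * n)) = odd (\<sigma> \<beta> (2 * n))" for n by simp
    then show ?thesis unfolding par by (rule ext)
  qed
  then have inj: "inj e" by (rule injI)
  define f where "f = y \<circ> inv e"
  have f: "f (e \<alpha>) = y \<alpha>" for \<alpha> by (simp add: f_def inj)
  have "|range e| =o continuum"
    unfolding continuum_eq by (rule ordIso_symmetric[OF card_of_ordIsoI[OF inj_on_imp_bij_betw[OF inj]]])
  moreover have "continuous_on (range e) f"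
    unfolding continuous_on_iff
  proof safe
    fix \<alpha> and \<epsilon> :: real assume "\<epsilon> > 0"
    then obtain n where n: "(1 / 3) ^ n < \<epsilon>" using real_arch_pow_inv[of \<epsilon> "1/3"] by auto
    \<comment> \<open>Within this radius the ranges agree up to \<open>\<sigma> \<alpha> n\<close>,
      hence so do the entries 0 to \<open>n\<close> and their parities.\<close>
    have *: "dist (f (e \<beta>)) (f (e \<alpha>)) < \<epsilon>" if d: "dist (e \<beta>) (e \<alpha>) < 1 / 2 / 3 ^ \<sigma> \<alpha> n" for \<beta>
    proof -
      have "\<sigma> \<alpha> j = \<sigma> \<beta> j" if "j \<le> n" for j
      proof (rule strict_mono_agree[OF sm sm])
        show "\<sigma> \<alpha> j \<le> \<sigma> \<alpha> n" using that strict_mono_less_eq[OF sm] by blast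
      qed (use agree d dist_commute in metis)
      then have "\<bar>y \<beta> - y \<alpha>\<bar> \<le> 3 / 2 / 3 ^ Suc n"
        unfolding y_def by (intro ternary_code_le_dist) auto
      also have "\<dots> \<le> (1 / 3) ^ n" by (simp add: power_one_over field_simps)
      finally show ?thesis using n by (simp add: f dist_real_def)
    qed
    then show "\<exists>d>0. \<forall>x'\<in>range e. dist x' (e \<alpha>) < d \<longrightarrow> dist (f x') (f (e \<alpha>)) < \<epsilon>"
      by (intro exI[of _ "1 / 2 / 3 ^ \<sigma> \<alpha> n"]) auto
  qed
  moreover have "\<not> uniformly_continuous_on A f" if A: "A \<subseteq> range e" "|A| =o continuum" for A
  proof
    assume u: "uniformly_continuous_on A f"
    define I where "I = {\<alpha>. e \<alpha> \<in> A}"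
    \<comment> \<open>Uniform continuity in combinatorial form: a part of the range whose length
      depends on \<open>j\<close> alone decides the parity of entry \<open>j\<close> throughout
      \<open>I\<close>.\<close>
    have "\<exists>N. \<forall>\<alpha>\<in>I. \<forall>\<beta>\<in>I. (\<forall>i\<le>N. i \<in> range (\<sigma> \<alpha>) \<longleftrightarrow> i \<in> range (\<sigma> \<beta>)) \<longrightarrow> odd (\<sigma> \<alpha> j) = odd (\<sigma> \<beta> j)" for j
    proof -
      have "0 < (1 / 2 / 3 ^ j :: real)" by simp
      then obtain d where "d > 0" and
        d: "\<forall>x\<in>A. \<forall>x'\<in>A. dist x' x < d \<longrightarrow> dist (f x') (f x) < 1 / 2 / 3 ^ j"
        using u unfolding uniformly_continuous_on_def by blast
      obtain n where n: "(1 / 3) ^ n < d" using real_arch_pow_inv[of d "1/3"] \<open>d > 0\<close> by auto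
      have "odd (\<sigma> \<alpha> j) = odd (\<sigma> \<beta> j)"
        if "\<alpha> \<in> I" "\<beta> \<in> I" "\<forall>i\<le>n. i \<in> range (\<sigma> \<alpha>) \<longleftrightarrow> i \<in> range (\<sigma> \<beta>)" for \<alpha> \<beta>
      proof -
        have "\<bar>e \<alpha> - e \<beta>\<bar> \<le> 3 / 2 / 3 ^ Suc n"
          unfolding e_def using that(3) by (intro ternary_code_le_dist) auto
        also have "\<dots> \<le> (1 / 3) ^ n" by (simp add: power_one_over field_simps)
        finally have "dist (e \<alpha>) (e \<beta>) < d" using n by (simp add: dist_real_def)
        then have "dist (y \<alpha>) (y \<beta>) < 1 / 2 / 3 ^ j"
          using d that(1,2) unfolding I_def f[symmetric] by blast
        then show ?thesis
          unfolding y_def dist_real_def by (rule ternary_code_agree) simp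
      qed
      then show ?thesis by blast
    qed
    then obtain N where N: "\<And>j \<alpha> \<beta>. \<alpha> \<in> I \<Longrightarrow> \<beta> \<in> I \<Longrightarrow>
        \<forall>i\<le>N j. i \<in> range (\<sigma> \<alpha>) \<longleftrightarrow> i \<in> range (\<sigma> \<beta>) \<Longrightarrow> odd (\<sigma> \<alpha> j) = odd (\<sigma> \<beta> j)"
      by metis
    \<comment> \<open>By the choice of \<open>N\<close>, all witnesses give the same parity; without
      a witness the guess is false.\<close>
    define G where "G s j \<longleftrightarrow> (\<exists>\<alpha>\<in>I. range (\<sigma> \<alpha>) \<inter> {..N j} = set_decode s \<inter> {..N j} \<and> odd (\<sigma> \<alpha> j))" for s j
    obtain \<beta> where \<beta>: "guess \<beta> = G" "bound \<beta> = N" using ex_guess_bound by blast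
    have "captured \<beta> (\<sigma> \<alpha>)" if "\<alpha> \<in> I" for \<alpha>
      unfolding captured_def \<beta>
    proof (intro allI impI, rule ccontr)
      fix k j
      let ?s = "\<sigma> \<alpha> ` {..<k}"
      assume ne: "odd (\<sigma> \<alpha> j) \<noteq> G (set_encode ?s) j" and "\<not> \<sigma> \<alpha> k \<le> N j"
      \<comment> \<open>Entries up to \<open>N j\<close> come before place \<open>k\<close>, so the
        first \<open>k\<close> entries determine the range up to \<open>N j\<close>.\<close>
      then have "l < k" if "\<sigma> \<alpha> l \<le> N j" for l
        using that strict_mono_less[OF sm, of \<alpha> l k] by linarith
      then have r: "range (\<sigma> \<alpha>) \<inter> {..N j} = ?s \<inter> {..N j}" by auto
      have "G (set_encode ?s) j \<longleftrightarrow>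
          (\<exists>\<beta>\<in>I. range (\<sigma> \<beta>) \<inter> {..N j} = range (\<sigma> \<alpha>) \<inter> {..N j} \<and> odd (\<sigma> \<beta> j))"
        unfolding G_def r by (simp add: set_encode_inverse)
      also have "\<dots> \<longleftrightarrow> odd (\<sigma> \<alpha> j)"
      proof -
        have "odd (\<sigma> \<beta> j) = odd (\<sigma> \<alpha> j)"
          if "\<beta> \<in> I" "range (\<sigma> \<beta>) \<inter> {..N j} = range (\<sigma> \<alpha>) \<inter> {..N j}" for \<beta>
        proof (rule N[OF that(1) \<open>\<alpha> \<in> I\<close>], intro allI impI)
          fix i assume "i \<le> N j"
          then show "i \<in> range (\<sigma> \<beta>) \<longleftrightarrow> i \<in> range (\<sigma> \<alpha>)"
            using that(2) by (metis Int_iff atMost_iff)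
        qed
        then show ?thesis using \<open>\<alpha> \<in> I\<close> by metis
      qed
      finally show False using ne by simp
    qed
    \<comment> \<open>Since \<open>\<beta>\<close> captures \<open>\<sigma> \<alpha>\<close> for
      every \<open>\<alpha>\<close> in \<open>I\<close>, it precedes no such
      \<open>\<alpha>\<close>. This confines \<open>I\<close> to the initial segment ending with
      \<open>\<beta>\<close>, which is too small.\<close>
    then have "\<beta> \<notin> ?prec \<alpha>" if "\<alpha> \<in> I" for \<alpha> using nc that by blast
    moreover have "\<beta> \<in> ?prec \<alpha> \<or> \<alpha> \<in> ?prec \<beta> \<or> \<alpha> = \<beta>" for \<alpha>
      using card_of_well_order_on[of "UNIV :: (nat \<Rightarrow> bool) set"]
      unfolding well_order_on_def linear_order_on_def total_on_def underS_def by blast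
    ultimately have "I \<subseteq> ?prec \<beta> \<union> {\<beta>}" by blast
    moreover have "A \<subseteq> e ` I" using A(1) by (auto simp: I_def)
    ultimately have "A \<subseteq> e ` (?prec \<beta> \<union> {\<beta>})" by blast
    then have "|A| \<le>o |?prec \<beta> \<union> {\<beta>}|"
      by (rule ordLeq_transitive[OF card_of_mono1 card_of_image])
    moreover have "|?prec \<beta> \<union> {\<beta>}| <o continuum"
      unfolding continuum_eq
    proof (rule card_of_Un_ordLess_infinite[OF infinite_continuum])
      show "|?prec \<beta>| <o |UNIV :: (nat \<Rightarrow> bool) set|" using prec unfolding continuum_eq .
      show "|{\<beta>}| <o |UNIV :: (nat \<Rightarrow> bool) set|"
        by (rule finite_ordLess_infinite[OF card_of_Well_order card_of_Well_order])
           (simp_all add: Field_card_of infinite_continuum)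
    qed
    ultimately have "|A| <o continuum" by (rule ordLeq_ordLess_trans)
    with A(2) show False using not_ordLess_ordIso[of "|A|" continuum] by simp
  qed
  ultimately show ?thesis unfolding C8_def by (intro exI conjI allI impI)
qed

theorem theorem3p8:
  fixes \<kappa> :: "'k rel"
  assumes "uncountable_cardinal \<kappa>"
    and "\<kappa> <o continuum"
    and "C9 continuum \<kappa>"
  shows "C8 continuum continuum"
  using C9_not_dominating[OF assms] by (rule C8_continuum_if_not_dominating)

end
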